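(* Let $\varphi\in\operatorname{LFM}(B_2)$ be hyperbolic. Then: (1) $(\varphi,B_2)$ is conjugated to $(\psi_1,\mathbb{H}^2)$ or $(\psi_2,\mathbb{H}^2)$, where $$\psi_1(u_1,u_2)=\left(\lambda u_1+2i\langle u_2,b\rangle+c,\ \sqrt{\lambda}\,\alpha u_2\right),$$ $$\psi_2(u_1,u_2)=\left(\lambda u_1+a,\ u_2+b\right),$$ for some $\lambda>1$ and $a,b,c,\alpha\in\mathbb{C}$. (2) Let $\alpha=e^{-\beta+i\gamma}$ with $\beta>0$ and $\gamma\in[0,2\pi)$. If $$\operatorname{Im}c\ge\frac{\lambda-1}{2\beta\ln\lambda}\,\frac{\left(\frac{\ln\lambda}{2}+\beta\right)^2+\gamma^2}{|\lambda-\sqrt{\lambda}\alpha|^2}\,|b|^2,$$ then $\psi_1$ can be embedded into a semigroup on $\mathbb{H}^2$. (3) If $$\operatorname{Im}a\ge\frac{\lambda-1}{\ln^2\lambda}|b|^2,$$ then $\psi_2$ can be embedded into a semigroup on $\mathbb{H}^2$.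
   Context: $B_N$ is the open unit ball of $\mathbb{C}^N$ and $\mathbb{H}^N=\{(u_1,u')\in\mathbb{C}\times\mathbb{C}^{N-1}:\operatorname{Im}u_1>|u'|^2\}$ the Siegel half-plane, biholomorphic to $B_N$. $\langle x,y\rangle=x\bar y$ for $x,y\in\mathbb{C}$, and $\ln^2\lambda=(\ln\lambda)^2$. The maps $\psi_1,\psi_2$ are understood to be self-maps of $\mathbb{H}^2$. A holomorphic map is linear fractional if it has the form $z\mapsto \frac{Az+B}{\langle z,C\rangle+D}$ with $A\in\mathbb{C}^{N\times N}$, $B,C\in\mathbb{C}^N$, $D\in\mathbb{C}$; $\operatorname{LFM}(B_N)$ is the set of linear fractional self-maps of $B_N$. If a holomorphic self-map $\varphi$ of $B_N$ has no fixed point in $B_N$, its iterates converge locally uniformly to a unique point $w\in\partial B_N$ (the Denjoy-Wolff point), and $\liminf_{z\to w}\frac{1-|\varphi(z)|^2}{1-|z|^2}=\delta\in(0,1]$ is its boundary dilation coefficient; $\varphi$ is hyperbolic if it has no fixed point in $B_N$ and $\delta\in(0,1)$. For holomorphic self-maps $\psi:D\to D$ and $\psi':D'\to D'$ of domains in $\mathbb{C}^N$, $(\psi,D)$ and $(\psi',D')$ are conjugated if there is a biholomorphic map $\sigma:D\to D'$ with $\psi=\sigma^{-1}\circ\psi'\circ\sigma$. A (continuous) semigroup $\{\varphi_t\}_{t\ge0}$ on a domain $D$ is a continuous homomorphism from the additive semigroup of non-negative reals into the composition semigroup of holomorphic self-maps of $D$ with the compact-open topology (so $\varphi_0=\mathrm{id}$,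 $\varphi_{t+s}=\varphi_t\circ\varphi_s$). A self-map $\varphi$ of $D$ can be embedded into a semigroup on $D$ if there is a semigroup $\{\varphi_t\}$ on $D$ with $\varphi_1=\varphi$. *)

theory Defs
  imports "HOL-Analysis.Analysis"
begin

(* Hermitian inner product on C^N, linear in the first argument; the inner product of the
   library on complex ^ 'n is only its real part. *)
definition herm :: "complex ^ 'n \<Rightarrow> complex ^ 'n \<Rightarrow> complex" where
  "herm z w = (\<Sum>i\<in>UNIV. z $ i * cnj (w $ i))"

(* The unit ball B_N is the library's ball 0 1, since the norm of complex ^ 'n is Euclidean. *)

definition siegel :: "(complex ^ 2) set" where
  "siegel = {u. Im (u $ 1) > (cmod (u $ 2))\<^sup>2}"

(* Holomorphy in several variables on an open set S: Frechet differentiable with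
   complex-linear derivative. *)
definition holomorphic_map_on :: "(complex ^ 'n \<Rightarrow> complex ^ 'm) \<Rightarrow> (complex ^ 'n) set \<Rightarrow> bool" where
  "holomorphic_map_on f S \<longleftrightarrow>
     (\<forall>z\<in>S. \<exists>f'. (f has_derivative f') (at z) \<and> (\<forall>c v. f' (c *s v) = c *s f' v))"

definition holomorphic_self_map :: "(complex ^ 'n \<Rightarrow> complex ^ 'n) \<Rightarrow> (complex ^ 'n) set \<Rightarrow> bool" where
  "holomorphic_self_map f D \<longleftrightarrow> holomorphic_map_on f D \<and> f ` D \<subseteq> D"

definition biholomorphic_map ::
  "(complex ^ 'n \<Rightarrow> complex ^ 'n) \<Rightarrow> (complex ^ 'n) set \<Rightarrow> (complex ^ 'n) set \<Rightarrow> bool" where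
  "biholomorphic_map f D D' \<longleftrightarrow>
     bij_betw f D D' \<and> holomorphic_map_on f D \<and> holomorphic_map_on (inv_into D f) D'"

(* Maps of a domain are total functions of which only the values on the domain matter. *)
definition conjugated ::
  "(complex ^ 'n \<Rightarrow> complex ^ 'n) \<Rightarrow> (complex ^ 'n) set \<Rightarrow>
   (complex ^ 'n \<Rightarrow> complex ^ 'n) \<Rightarrow> (complex ^ 'n) set \<Rightarrow> bool" where
  "conjugated f D f' D' \<longleftrightarrow>
     holomorphic_self_map f D \<and> holomorphic_self_map f' D' \<and>
     (\<exists>\<sigma>. biholomorphic_map \<sigma> D D' \<and> (\<forall>z\<in>D. f z = inv_into D \<sigma> (f' (\<sigma> z))))"

definition LFM :: "(complex ^ 'n \<Rightarrow> complex ^ 'n) set" where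
  "LFM = {\<phi>. holomorphic_self_map \<phi> (ball 0 1) \<and>
     (\<exists>(A :: complex ^ 'n ^ 'n) (B :: complex ^ 'n) (C :: complex ^ 'n) (D :: complex).
        \<forall>z \<in> ball 0 1. herm z C + D \<noteq> 0 \<and>
          \<phi> z = (1 / (herm z C + D)) *s (A *v z + B))}"

(* Locally uniform convergence of the iterates on the ball to the boundary point w,
   which this convergence determines uniquely. *)
definition denjoy_wolff_point :: "(complex ^ 'n \<Rightarrow> complex ^ 'n) \<Rightarrow> complex ^ 'n \<Rightarrow> bool" where
  "denjoy_wolff_point \<phi> w \<longleftrightarrow> w \<in> sphere 0 1 \<and>
     (\<forall>z \<in> ball 0 1. \<exists>U. open U \<and> z \<in> U \<and> U \<subseteq> ball 0 1 \<and>
        uniform_limit U (\<lambda>n. \<phi> ^^ n) (\<lambda>_. w) sequentially)"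

definition dilation_coefficient :: "(complex ^ 'n \<Rightarrow> complex ^ 'n) \<Rightarrow> complex ^ 'n \<Rightarrow> ereal" where
  "dilation_coefficient \<phi> w =
     Liminf (at w within ball 0 1) (\<lambda>z. ereal ((1 - (norm (\<phi> z))\<^sup>2) / (1 - (norm z)\<^sup>2)))"

(* The Denjoy-Wolff point exists and is unique for every fixed-point free holomorphic self-map
   of the ball, so the existential quantifier only serves to name it. *)
definition hyperbolic :: "(complex ^ 'n \<Rightarrow> complex ^ 'n) \<Rightarrow> bool" where
  "hyperbolic \<phi> \<longleftrightarrow> holomorphic_self_map \<phi> (ball 0 1) \<and>
     (\<forall>z \<in> ball 0 1. \<phi> z \<noteq> z) \<and>
     (\<exists>w. denjoy_wolff_point \<phi> w \<and>
        0 < dilation_coefficient \<phi> w \<and> dilation_coefficient \<phi> w < 1)"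

(* Compact-open topology on the set of holomorphic self-maps of D. Taking K empty shows that
   its topspace consists of all of them. *)
definition compact_open_topology :: "(complex ^ 'n) set \<Rightarrow> (complex ^ 'n \<Rightarrow> complex ^ 'n) topology" where
  "compact_open_topology D = topology_generated_by
     {{f. holomorphic_self_map f D \<and> f ` K \<subseteq> U} | K U. compact K \<and> K \<subseteq> D \<and> open U}"

definition continuous_semigroup ::
  "(real \<Rightarrow> complex ^ 'n \<Rightarrow> complex ^ 'n) \<Rightarrow> (complex ^ 'n) set \<Rightarrow> bool" where
  "continuous_semigroup \<Phi> D \<longleftrightarrow>
     (\<forall>t\<ge>0. holomorphic_self_map (\<Phi> t) D) \<and>
     (\<forall>z\<in>D. \<Phi> 0 z = z) \<and>
     (\<forall>s\<ge>0. \<forall>t\<ge>0. \<forall>z\<in>D. \<Phi> (t + s) z = \<Phi> t (\<Phi> s z)) \<and>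
     continuous_map (top_of_set {0..}) (compact_open_topology D) \<Phi>"

definition embeddable :: "(complex ^ 'n \<Rightarrow> complex ^ 'n) \<Rightarrow> (complex ^ 'n) set \<Rightarrow> bool" where
  "embeddable f D \<longleftrightarrow> (\<exists>\<Phi>. continuous_semigroup \<Phi> D \<and> (\<forall>z\<in>D. \<Phi> 1 z = f z))"

definition psi1 :: "real \<Rightarrow> complex \<Rightarrow> complex \<Rightarrow> complex \<Rightarrow> complex ^ 2 \<Rightarrow> complex ^ 2" where
  "psi1 lam \<alpha> b c u = vector
     [of_real lam * u $ 1 + 2 * \<i> * (u $ 2 * cnj b) + c, of_real (sqrt lam) * \<alpha> * u $ 2]"

definition psi2 :: "real \<Rightarrow> complex \<Rightarrow> complex \<Rightarrow> complex ^ 2 \<Rightarrow> complex ^ 2" where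
  "psi2 lam a b u = vector [of_real lam * u $ 1 + a, u $ 2 + b]"

end

(*
  Let w be the Denjoy-Wolff point. The formula for phi extends continuously to w and fixes it, so a
  Cayley transform sending w to infinity turns phi into an affine self-map (r u1 + p u2 + c, q u2 + d) of the Siegel
  half-plane with r > 0. Since the dilation coefficient is at least 1/r, hyperbolicity gives r > 1.
  A Heisenberg translation then removes d if q is not 1, and p if q = 1.

  The embeddings are the explicit affine semigroups with first coefficient lam^t. Such a map preserves
  the half-plane iff a real quadratic form in u2 is nonnegative for all t >= 0. For psi2 this is
  x^2 e^x <= (e^x - 1)^2 with x = t ln lam. For psi1 the form vanishes at t = 0, and the hypothesis on
  Im c makes its derivative in t bounded below by a square.
*)
theory Submission
  imports Defs
begin

section \<open>Holomorphic maps in several variables\<close>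

text \<open>Fixing \<open>w\<close> does not at once make the transformed map affine. In Siegel
  coordinates the components of \<open>\<phi>\<close> along \<open>w\<close> and
  \<open>perp w\<close> are quotients of affine functions over a common denominator; fixing
  \<open>w\<close> only removes \<open>u1\<close> from the denominator of the Cayley transform. What
  is left is an affine function of \<open>u2\<close> without zeros, and since \<open>u2\<close>
  takes every complex value on the half-plane, it is constant.

  The thresholds in the embedding criteria are infinitesimal. Since the quadratic form in
  \<open>u2\<close> vanishes at t = 0, its t-derivative there has to be nonnegative, and completing
  the square in that derivative gives exactly the stated bounds on Im a and Im c. The task is to
  show that this condition at t = 0 suffices for all t. For psi1, dividing by lam^t first makes the
  three terms of the derivative decay at the rates 2 \<beta>, (ln lam) / 2 + \<beta> and ln lam; the
  middle rate is the mean of the others, so the discriminant condition persists.\<close>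

definition complex_differentiable_at :: "(complex ^ 'n \<Rightarrow> complex) \<Rightarrow> complex ^ 'n \<Rightarrow> bool" where
  "complex_differentiable_at f z \<longleftrightarrow>
     (\<exists>f'. (f has_derivative f') (at z) \<and> (\<forall>c v. f' (c *s v) = c * f' v))"

lemma complex_differentiable_at_const: "complex_differentiable_at (\<lambda>_. c) z"
  unfolding complex_differentiable_at_def by (rule exI[of _ "\<lambda>_. 0"]) auto

lemma complex_differentiable_at_nth: "complex_differentiable_at (\<lambda>z. z $ i) z"
  unfolding complex_differentiable_at_def
  by (rule exI[of _ "\<lambda>v. v $ i"])
     (auto intro: bounded_linear_imp_has_derivative bounded_linear_vec_nth)

lemma complex_differentiable_at_add:
  assumes "complex_differentiable_at f z" "complex_differentiable_at g z"
  shows "complex_differentiable_at (\<lambda>z. f z + g z) z"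
proof -
  obtain f' g' where
    "(f has_derivative f') (at z)" "\<And>c v. f' (c *s v) = c * f' v"
    "(g has_derivative g') (at z)" "\<And>c v. g' (c *s v) = c * g' v"
    using assms unfolding complex_differentiable_at_def by auto
  then show ?thesis
    unfolding complex_differentiable_at_def
    by (intro exI[of _ "\<lambda>v. f' v + g' v"]) (auto intro: has_derivative_add simp: algebra_simps)
qed

lemma complex_differentiable_at_mult:
  assumes "complex_differentiable_at f z" "complex_differentiable_at g z"
  shows "complex_differentiable_at (\<lambda>z. f z * g z) z"
proof -
  obtain f' g' where
    "(f has_derivative f') (at z)" "\<And>c v. f' (c *s v) = c * f' v"
    "(g has_derivative g') (at z)" "\<And>c v. g' (c *s v) = c * g' v"
    using assms unfolding complex_differentiable_at_def by auto
  then show ?thesis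
    unfolding complex_differentiable_at_def
    by (intro exI[of _ "\<lambda>v. f z * g' v + f' v * g z"])
       (auto intro: has_derivative_mult simp: algebra_simps)
qed

lemma complex_differentiable_at_inverse:
  assumes "complex_differentiable_at f z" "f z \<noteq> 0"
  shows "complex_differentiable_at (\<lambda>z. inverse (f z)) z"
proof -
  obtain f' where
    "(f has_derivative f') (at z)" "\<And>c v. f' (c *s v) = c * f' v"
    using assms unfolding complex_differentiable_at_def by auto
  then show ?thesis
    unfolding complex_differentiable_at_def using assms(2)
    by (intro exI[of _ "\<lambda>v. - (inverse (f z) * f' v * inverse (f z))"])
       (auto intro!: derivative_eq_intros simp: algebra_simps)
qed

lemma complex_differentiable_at_diff:
  assumes "complex_differentiable_at f z" "complex_differentiable_at g z"
  shows "complex_differentiable_at (\<lambda>z. f z - g z) z"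
proof -
  have "complex_differentiable_at (\<lambda>z. f z + (-1) * g z) z"
    by (intro complex_differentiable_at_add complex_differentiable_at_mult
        complex_differentiable_at_const assms)
  then show ?thesis by simp
qed

lemma complex_differentiable_at_divide:
  assumes "complex_differentiable_at f z" "complex_differentiable_at g z" "g z \<noteq> 0"
  shows "complex_differentiable_at (\<lambda>z. f z / g z) z"
proof -
  have "complex_differentiable_at (\<lambda>z. f z * inverse (g z)) z"
    by (intro complex_differentiable_at_mult complex_differentiable_at_inverse assms)
  then show ?thesis by (simp add: divide_inverse)
qed

lemmas complex_differentiable_intros =
  complex_differentiable_at_const complex_differentiable_at_nth
  complex_differentiable_at_add complex_differentiable_at_diff
  complex_differentiable_at_mult complex_differentiable_at_divide

text \<open>The coordinate derivatives assemble into one complex-linear Frechet derivative, so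
  explicit formulas can be checked coordinate by coordinate with the closure rules above.\<close>

lemma holomorphic_map_onI:
  fixes f :: "complex ^ 'n \<Rightarrow> complex ^ 'm"
  assumes "\<And>z i. z \<in> S \<Longrightarrow> complex_differentiable_at (\<lambda>z. f z $ i) z"
  shows "holomorphic_map_on f S"
  unfolding holomorphic_map_on_def
proof
  fix z assume "z \<in> S"
  then have "\<forall>i. \<exists>f'. ((\<lambda>z. f z $ i) has_derivative f') (at z) \<and> (\<forall>c v. f' (c *s v) = c * f' v)"
    using assms unfolding complex_differentiable_at_def by blast
  then obtain F where F: "\<And>i. ((\<lambda>z. f z $ i) has_derivative F i) (at z)"
    "\<And>i c v. F i (c *s v) = c * F i v"
    by metis
  have "(f has_derivative (\<lambda>v. \<chi> i. F i v)) (at z)"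
  proof (subst has_derivative_componentwise_within, rule ballI)
    fix b :: "complex ^ 'm" assume "b \<in> Basis"
    then obtain i u where b: "b = axis i u"
      by (auto simp: Basis_vec_def)
    show "((\<lambda>x. f x \<bullet> b) has_derivative (\<lambda>x. (\<chi> i. F i x) \<bullet> b)) (at z)"
      using has_derivative_inner_left[OF F(1)[of i], of u] by (simp add: b inner_axis)
  qed
  moreover have "(\<chi> i. F i (c *s v)) = c *s (\<chi> i. F i v)" for c v
    by (simp add: vec_eq_iff F(2))
  ultimately show "\<exists>f'. (f has_derivative f') (at z) \<and> (\<forall>c v. f' (c *s v) = c *s f' v)"
    by blast
qed

lemma holomorphic_map_on_compose:
  assumes "holomorphic_map_on f S" "holomorphic_map_on g T" "f ` S \<subseteq> T"
  shows "holomorphic_map_on (g \<circ> f) S"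
  unfolding holomorphic_map_on_def
proof
  fix z assume z: "z \<in> S"
  then obtain f' where f': "(f has_derivative f') (at z)" "\<And>c v. f' (c *s v) = c *s f' v"
    using assms(1) unfolding holomorphic_map_on_def by blast
  obtain g' where g': "(g has_derivative g') (at (f z))" "\<And>c v. g' (c *s v) = c *s g' v"
    using assms(2,3) z unfolding holomorphic_map_on_def by blast
  have "(g \<circ> f has_derivative g' \<circ> f') (at z)"
    using f' g' by (intro diff_chain_at)
  then show "\<exists>h'. (g \<circ> f has_derivative h') (at z) \<and> (\<forall>c v. h' (c *s v) = c *s h' v)"
    using f'(2) g'(2) by (intro exI[of _ "g' \<circ> f'"]) auto
qed

lemma holomorphic_map_on_cong:
  assumes "holomorphic_map_on f S" "open S" "\<And>z. z \<in> S \<Longrightarrow> f z = g z"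
  shows "holomorphic_map_on g S"
  unfolding holomorphic_map_on_def
proof
  fix z assume z: "z \<in> S"
  then obtain f' where f': "(f has_derivative f') (at z)" "\<And>c v. f' (c *s v) = c *s f' v"
    using assms(1) unfolding holomorphic_map_on_def by blast
  have "(g has_derivative f') (at z)"
    by (rule has_derivative_transform_within_open[OF f'(1) assms(2) z]) (use assms(3) in auto)
  with f'(2) show "\<exists>f'. (g has_derivative f') (at z) \<and> (\<forall>c v. f' (c *s v) = c *s f' v)"
    by blast
qed

text \<open>An explicit two-sided inverse \<open>\<tau>\<close> replaces \<open>inv_into\<close>. On
  \<open>D'\<close> the map \<open>f'\<close> is \<open>\<sigma> \<circ> f \<circ> \<tau>\<close>,
  from which it inherits holomorphy and the self-map property.\<close>

lemma conjugatedI: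
  assumes "open D'"
    and f: "holomorphic_self_map f D" and \<sigma>: "holomorphic_map_on \<sigma> D" "\<sigma> ` D \<subseteq> D'"
    and \<tau>: "holomorphic_map_on \<tau> D'" "\<tau> ` D' \<subseteq> D"
    and inv: "\<And>z. z \<in> D \<Longrightarrow> \<tau> (\<sigma> z) = z" "\<And>u. u \<in> D' \<Longrightarrow> \<sigma> (\<tau> u) = u"
    and f': "\<And>u. u \<in> D' \<Longrightarrow> \<sigma> (f (\<tau> u)) = f' u"
  shows "conjugated f D f' D'"
proof -
  have bij: "bij_betw \<sigma> D D'"
    by (rule bij_betw_byWitness[where f' = \<tau>]) (use \<sigma> \<tau> inv in auto)
  have inv_eq: "inv_into D \<sigma> u = \<tau> u" if "u \<in> D'" for u
    using bij that inv \<tau>(2) by (metis bij_betw_def image_subset_iff inv_into_f_eq)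
  have bihol: "biholomorphic_map \<sigma> D D'"
    unfolding biholomorphic_map_def
    using bij \<sigma>(1) holomorphic_map_on_cong[OF \<tau>(1) assms(1)] inv_eq by auto
  have "holomorphic_map_on (\<sigma> \<circ> (f \<circ> \<tau>)) D'"
    using f \<tau> \<sigma>(1) unfolding holomorphic_self_map_def
    by (intro holomorphic_map_on_compose[of _ _ _ D] holomorphic_map_on_compose[of \<tau> _ f D]) auto
  then have "holomorphic_map_on f' D'"
    by (rule holomorphic_map_on_cong[OF _ assms(1)]) (use f' in auto)
  moreover have f'_sub: "f' u \<in> D'" if "u \<in> D'" for u
    using that f \<sigma>(2) \<tau>(2) unfolding holomorphic_self_map_def
    by (subst f'[OF that, symmetric]) blast
  moreover have "f z = inv_into D \<sigma> (f' (\<sigma> z))" if "z \<in> D" for z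
    using that f \<sigma>(2) inv inv_eq f' f'_sub unfolding holomorphic_self_map_def
    by (metis image_subset_iff)
  ultimately show ?thesis
    unfolding conjugated_def holomorphic_self_map_def
    using f bihol unfolding holomorphic_self_map_def by auto
qed

section \<open>Affine maps of the Siegel half-plane and their semigroups\<close>

lemma open_siegel: "open siegel"
  unfolding siegel_def by (intro open_Collect_less continuous_intros)

lemma vec2_eqI: "x $ 1 = y $ 1 \<Longrightarrow> x $ 2 = y $ 2 \<Longrightarrow> (x :: 'a ^ 2) = y"
  by (simp add: vec_eq_iff forall_2)

text \<open>A family closed under composition that contains both normal forms, the Heisenberg
  translations and the Cayley transforms of the given maps.\<close>

definition aff :: "complex \<Rightarrow> complex \<Rightarrow> complex \<Rightarrow> complex \<Rightarrow> complex \<Rightarrow> complex ^ 2 \<Rightarrow> complex ^ 2" where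
  "aff l p c q d u = vector [l * u $ 1 + p * u $ 2 + c, q * u $ 2 + d]"

lemma aff_nth [simp]:
  "aff l p c q d u $ 1 = l * u $ 1 + p * u $ 2 + c"
  "aff l p c q d u $ 2 = q * u $ 2 + d"
  by (simp_all add: aff_def)

lemma holomorphic_map_on_aff: "holomorphic_map_on (aff l p c q d) S"
proof (rule holomorphic_map_onI)
  fix z :: "complex ^ 2" and i :: 2
  have "\<forall>i. complex_differentiable_at (\<lambda>z. aff l p c q d z $ i) z"
    unfolding forall_2 aff_nth by (intro conjI complex_differentiable_intros)
  then show "complex_differentiable_at (\<lambda>z. aff l p c q d z $ i) z" ..
qed

text \<open>Joint continuity suffices by the tube lemma: if \<open>{t} \<times> K\<close> lies in
  the open preimage of \<open>U\<close>, compactness of \<open>K\<close> gives a whole neighbourhood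
  of \<open>t\<close> with the same property.\<close>

lemma continuous_map_compact_open_topologyI:
  assumes hol: "\<And>t. t \<in> T \<Longrightarrow> holomorphic_self_map (\<Phi> t) D"
    and cont: "continuous_on UNIV (\<lambda>(t, z). \<Phi> t z)"
  shows "continuous_map (top_of_set T) (compact_open_topology D) \<Phi>"
  unfolding compact_open_topology_def
proof (rule continuous_on_generated_topo)
  fix V assume "V \<in> {{f. holomorphic_self_map f D \<and> f ` K \<subseteq> U} | K U. compact K \<and> K \<subseteq> D \<and> open U}"
  then obtain K U where V: "V = {f. holomorphic_self_map f D \<and> f ` K \<subseteq> U}"
    and K: "compact K" and U: "open U"
    by blast
  define W where "W = (\<lambda>(t, z). \<Phi> t z) -` U"
  have "open W"
    unfolding W_def using cont U by (simp add: open_vimage)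
  have "open {t. \<Phi> t ` K \<subseteq> U}"
  proof (subst open_subopen, rule ballI)
    fix t assume "t \<in> {t. \<Phi> t ` K \<subseteq> U}"
    then have "{t} \<times> K \<subseteq> W" by (auto simp: W_def)
    then obtain X where "t \<in> X" "open X" "X \<times> K \<subseteq> W"
      using Elementary_Topology.tube_lemma[OF K \<open>open W\<close>] by blast
    moreover from this have "X \<subseteq> {t. \<Phi> t ` K \<subseteq> U}"
      by (auto simp: W_def)
    ultimately show "\<exists>X. open X \<and> t \<in> X \<and> X \<subseteq> {t. \<Phi> t ` K \<subseteq> U}" by blast
  qed
  moreover have "\<Phi> -` V \<inter> topspace (top_of_set T) = T \<inter> {t. \<Phi> t ` K \<subseteq> U}"
    using hol by (auto simp: V)
  ultimately show "openin (top_of_set T) (\<Phi> -` V \<inter> topspace (top_of_set T))"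
    by (simp add: openin_open_Int)
next
  show "\<Phi> ` topspace (top_of_set T) \<subseteq>
      \<Union> {{f. holomorphic_self_map f D \<and> f ` K \<subseteq> U} | K U. compact K \<and> K \<subseteq> D \<and> open U}"
    using hol by (auto intro!: exI[of _ "{f. holomorphic_self_map f D}"] exI[of _ "{}"])
qed

text \<open>The inequality is the condition on boundary points, where Im u1 = |u2|^2; since
  \<open>r\<close> is positive, the strict surplus of an interior point survives.\<close>

lemma aff_siegel:
  assumes "0 < r"
    and "\<And>v. (cmod (q * v + d))\<^sup>2 \<le> r * (cmod v)\<^sup>2 + Im (p * v + c)"
    and "u \<in> siegel"
  shows "aff (of_real r) p c q d u \<in> siegel"
proof -
  have "r * (cmod (u $ 2))\<^sup>2 < r * Im (u $ 1)"
    using assms(1,3) by (simp add: siegel_def)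
  with assms(2)[of "u $ 2"] show ?thesis
    by (simp add: siegel_def)
qed

text \<open>The equations \<open>add\<close> are the entries of the product of the upper triangular
  matrices with rows (r, P, C), (0, Q, R), (0, 0, 1) that represent the affine maps.\<close>

lemma embeddable_aff:
  fixes r :: "real \<Rightarrow> real" and P C Q R :: "real \<Rightarrow> complex"
  assumes cont: "continuous_on UNIV r" "continuous_on UNIV P" "continuous_on UNIV C"
      "continuous_on UNIV Q" "continuous_on UNIV R"
    and pos: "\<And>t. t \<ge> 0 \<Longrightarrow> r t > 0"
    and self: "\<And>t v. t \<ge> 0 \<Longrightarrow>
      (cmod (Q t * v + R t))\<^sup>2 \<le> r t * (cmod v)\<^sup>2 + Im (P t * v + C t)"
    and zero: "r 0 = 1" "P 0 = 0" "C 0 = 0" "Q 0 = 1" "R 0 = 0"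
    and add: "\<And>s t. s \<ge> 0 \<Longrightarrow> t \<ge> 0 \<Longrightarrow> r (t + s) = r t * r s"
      "\<And>s t. s \<ge> 0 \<Longrightarrow> t \<ge> 0 \<Longrightarrow> P (t + s) = of_real (r t) * P s + P t * Q s"
      "\<And>s t. s \<ge> 0 \<Longrightarrow> t \<ge> 0 \<Longrightarrow> C (t + s) = of_real (r t) * C s + P t * R s + C t"
      "\<And>s t. s \<ge> 0 \<Longrightarrow> t \<ge> 0 \<Longrightarrow> Q (t + s) = Q t * Q s"
      "\<And>s t. s \<ge> 0 \<Longrightarrow> t \<ge> 0 \<Longrightarrow> R (t + s) = Q t * R s + R t"
    and one: "\<And>u. u \<in> siegel \<Longrightarrow> f u = aff (of_real (r 1)) (P 1) (C 1) (Q 1) (R 1) u"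
  shows "embeddable f siegel"
proof -
  define \<Phi> where "\<Phi> t = aff (of_real (r t)) (P t) (C t) (Q t) (R t)" for t
  have hol: "holomorphic_self_map (\<Phi> t) siegel" if "t \<ge> 0" for t
    unfolding holomorphic_self_map_def \<Phi>_def
    using that pos self aff_siegel holomorphic_map_on_aff by blast
  have "continuous_on UNIV (\<lambda>(t, z). \<Phi> t z)"
  proof -
    have eq: "(\<lambda>(t, z). \<Phi> t z) = (\<lambda>x::real \<times> (complex ^ 2). \<chi> i. if i = 1
        then of_real (r (fst x)) * ((snd x) $ 1) + P (fst x) * ((snd x) $ 2) + C (fst x)
        else Q (fst x) * ((snd x) $ 2) + R (fst x))"
      by (auto intro!: vec2_eqI simp: \<Phi>_def fun_eq_iff)
    have fst: "continuous_on UNIV (\<lambda>x::real \<times> (complex ^ 2). g (fst x))"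
      if "continuous_on UNIV g" for g :: "real \<Rightarrow> 'b::topological_space"
      by (rule continuous_on_compose2[OF that]) (auto intro: continuous_intros)
    have "continuous_on UNIV (\<lambda>x::real \<times> (complex ^ 2). if i = (1::2)
        then of_real (r (fst x)) * ((snd x) $ 1) + P (fst x) * ((snd x) $ 2) + C (fst x)
        else Q (fst x) * ((snd x) $ 2) + R (fst x))" for i
      by (cases "i = 1") (auto intro!: continuous_intros fst cont)
    then show ?thesis
      unfolding eq by (intro continuous_on_vec_lambda)
  qed
  then have "continuous_map (top_of_set {0..}) (compact_open_topology siegel) \<Phi>"
    by (intro continuous_map_compact_open_topologyI) (use hol in auto)
  moreover have "\<Phi> (t + s) u = \<Phi> t (\<Phi> s u)" if "s \<ge> 0" "t \<ge> 0" for s t u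
    unfolding \<Phi>_def add[OF that] by (rule vec2_eqI) (simp_all add: algebra_simps)
  moreover have "\<Phi> 0 u = u" for u
    by (rule vec2_eqI) (simp_all add: \<Phi>_def zero)
  ultimately have "continuous_semigroup \<Phi> siegel"
    unfolding continuous_semigroup_def using hol by blast
  then show ?thesis
    unfolding embeddable_def using one by (auto simp: \<Phi>_def)
qed

text \<open>Dividing by \<open>exp x\<close> and taking roots reduces this to x <= 2 sinh (x/2),
  which follows from cosh >= 1 by monotonicity.\<close>

lemma sq_mult_exp_le:
  fixes x :: real
  assumes "0 \<le> x"
  shows "x\<^sup>2 * exp x \<le> (exp x - 1)\<^sup>2"
proof -
  have "exp (0/2) - exp (-0/2) - 0 \<le> exp (x/2) - exp (-x/2) - x"
  proof (rule DERIV_nonneg_imp_nondecreasing[OF assms])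
    fix y :: real
    \<comment> \<open>Half of this square is cosh (y/2) - 1, the derivative in question.\<close>
    have "0 \<le> (exp (y/4) - exp (-y/4))\<^sup>2" by simp
    also have "(exp (y/4) - exp (-y/4))\<^sup>2 = exp (y/2) + exp (-y/2) - 2"
      by (simp add: power2_eq_square algebra_simps flip: exp_add)
    finally have "0 \<le> exp (y/2) / 2 + exp (-y/2) / 2 - 1" by simp
    moreover have "((\<lambda>x. exp (x/2) - exp (-x/2) - x) has_real_derivative
        (exp (y/2) / 2 + exp (-y/2) / 2 - 1)) (at y)"
      by (auto intro!: derivative_eq_intros)
    ultimately show "\<exists>d. ((\<lambda>x. exp (x/2) - exp (-x/2) - x) has_real_derivative d) (at y) \<and> 0 \<le> d"
      by blast
  qed
  then have "x * exp (x/2) \<le> (exp (x/2) - exp (-x/2)) * exp (x/2)"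
    by (intro mult_right_mono) auto
  also have "\<dots> = exp x - 1"
    by (simp add: algebra_simps flip: exp_add)
  finally have "(x * exp (x/2))\<^sup>2 \<le> (exp x - 1)\<^sup>2"
    using assms by (intro power_mono) auto
  then show ?thesis
    by (simp add: power_mult_distrib flip: exp_double)
qed

text \<open>With \<open>u2\<close> translated by t b and \<open>u1\<close> scaled by lam^t, the
  constant term must satisfy \<open>C (t + s) = exp (t * L) * C s + C t\<close>. Symmetry in
  \<open>s\<close> and \<open>t\<close> forces it to be proportional to
  \<open>exp (t * L) - 1\<close>, and \<open>C 1 = a\<close> fixes the factor.\<close>

lemma embeddable_psi2:
  assumes lam: "lam > 1" and a: "Im a \<ge> (lam - 1) / (ln lam)\<^sup>2 * (cmod b)\<^sup>2"
  shows "embeddable (psi2 lam a b) siegel"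
proof -
  define L where "L = ln lam"
  have L: "L > 0" "exp L = lam" using lam by (simp_all add: L_def)
  define a' where "a' = a / of_real (lam - 1)"
  have a': "Im a' = Im a / (lam - 1)" "a' * of_real (lam - 1) = a"
    using lam by (simp_all only: a'_def Im_divide_of_real) simp
  define C where "C t = a' * of_real (exp (t * L) - 1)" for t
  show ?thesis
  proof (rule embeddable_aff[where r = "\<lambda>t. exp (t * L)" and P = "\<lambda>_. 0" and C = C
        and Q = "\<lambda>_. 1" and R = "\<lambda>t. of_real t * b"])
    fix t :: real and v :: complex
    assume t: "0 \<le> t"
    show "(cmod (1 * v + of_real t * b))\<^sup>2 \<le> exp (t * L) * (cmod v)\<^sup>2 + Im (0 * v + C t)"
    \<comment> \<open>The divisor \<open>y\<close> used below vanishes at t = 0.\<close>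
    proof (cases "t = 0")
      case True
      then show ?thesis by (simp add: C_def)
    next
      case False
      define y where "y = exp (t * L) - 1"
      define s where "s = t * cmod b"
      have y: "y > 0" using False t L by (simp add: y_def)
      have "t\<^sup>2 * (1 + y) \<le> y\<^sup>2 / L\<^sup>2"
        using sq_mult_exp_le[of "t * L"] t L by (simp add: y_def field_simps)
      then have "t\<^sup>2 * (1 + y) * (cmod b)\<^sup>2 \<le> y\<^sup>2 / L\<^sup>2 * (cmod b)\<^sup>2"
        by (intro mult_right_mono) auto
      then have "s\<^sup>2 * (1 + y) \<le> y\<^sup>2 / L\<^sup>2 * (cmod b)\<^sup>2"
        by (simp add: s_def power_mult_distrib mult_ac)
      then have "s\<^sup>2 * (1 + y) / y \<le> (y\<^sup>2 / L\<^sup>2 * (cmod b)\<^sup>2) / y"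
        using y by (intro divide_right_mono) auto
      also have "\<dots> = ((lam - 1) / L\<^sup>2 * (cmod b)\<^sup>2) * (y / (lam - 1))"
        using y lam L by (simp add: field_simps power2_eq_square)
      also have "\<dots> \<le> Im a * (y / (lam - 1))"
        using a y lam by (intro mult_right_mono) (auto simp: L_def)
      also have "\<dots> = Im (C t)" by (simp add: C_def y_def a')
      finally have C: "s\<^sup>2 * (1 + y) / y \<le> Im (C t)" .
      have "cmod (v + of_real t * b) \<le> cmod v + s"
        using norm_triangle_ineq[of v "of_real t * b"] t by (simp add: s_def norm_mult)
      then have "(cmod (v + of_real t * b))\<^sup>2 \<le> (cmod v + s)\<^sup>2"
        by (intro power_mono) auto
      \<comment> \<open>Completing the square in \<open>cmod v\<close>: the excess over
        \<open>(1 + y) * (cmod v)\<^sup>2\<close> is largest at \<open>cmod v = s / y\<close>, and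
        this largest value is what \<open>Im (C t)\<close> has to dominate.\<close>
      also have "(cmod v + s)\<^sup>2 + (y * cmod v - s)\<^sup>2 / y = (1 + y) * (cmod v)\<^sup>2 + s\<^sup>2 * (1 + y) / y"
        using y by (simp add: field_simps power2_eq_square)
      then have "(cmod v + s)\<^sup>2 \<le> (1 + y) * (cmod v)\<^sup>2 + s\<^sup>2 * (1 + y) / y"
        using divide_nonneg_pos[of "(y * cmod v - s)\<^sup>2" y] y zero_le_power2 by smt
      finally show ?thesis
        using C by (simp add: y_def)
    qed
  next
    show "C (t + s) = of_real (exp (t * L)) * C s + 0 * (of_real s * b) + C t" for s t
      by (simp add: C_def exp_add algebra_simps)
  next
    fix u :: "complex ^ 2"
    show "psi2 lam a b u =
        aff (of_real (exp (1 * L))) 0 (C 1) 1 (of_real 1 * b) u"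
      using lam L by (intro vec2_eqI) (auto simp: psi2_def C_def a'(2)[simplified])
  qed (auto intro!: continuous_intros simp: C_def exp_add algebra_simps L lam)
qed

text \<open>The expression vanishes at \<open>t = 0\<close>, and its derivative in \<open>t\<close> is bounded below by
  \<open>(sqrt q * exp (- q * t / 2) * cmod v - cmod (z * k) * exp (- p * t / 2) / sqrt q)\<^sup>2\<close>.\<close>

lemma semigroup_form_nonneg:
  fixes p q t :: real and v k z :: complex
  assumes p: "p > 0" and q: "q > 0" and z: "Re z = (p + q) / 2" and t: "t \<ge> 0"
  shows "0 \<le> (1 - exp (- q * t)) * (cmod v)\<^sup>2 + 2 * Re (v * k * (1 - exp (- (of_real t * z))))
    + (cmod (z * k))\<^sup>2 / (p * q) * (1 - exp (- p * t))"
proof -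
  define h where "h t = Re (v * k * (1 - exp (- (of_real t * z))))" for t
  define G where "G t = (1 - exp (- q * t)) * (cmod v)\<^sup>2 + 2 * h t
    + (cmod (z * k))\<^sup>2 / (p * q) * (1 - exp (- p * t))" for t
  define G' where "G' t = q * exp (- q * t) * (cmod v)\<^sup>2
    + 2 * Re (v * k * (z * exp (- (of_real t * z))))
    + (cmod (z * k))\<^sup>2 / q * exp (- p * t)" for t
  have "G 0 \<le> G t"
  proof (rule DERIV_nonneg_imp_nondecreasing[OF t])
    fix s :: real
    have "((\<lambda>t. exp (- (of_real t * z))) has_vector_derivative - (z * exp (- (of_real s * z)))) (at s)"
    proof -
      have "((\<lambda>w. exp (- (w * z))) has_field_derivative - (z * exp (- (of_real s * z)))) (at (of_real s))"
        by (auto intro!: derivative_eq_intros)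
      then show ?thesis
        using has_vector_derivative_real_field by fastforce
    qed
    then have "((\<lambda>t. v * k * (1 - exp (- (of_real t * z)))) has_vector_derivative
        v * k * (z * exp (- (of_real s * z)))) (at s)"
      by (auto intro!: derivative_eq_intros)
    then have h: "(h has_real_derivative
        Re (v * k * (z * exp (- (of_real s * z))))) (at s)"
      unfolding h_def has_real_derivative_iff_has_vector_derivative
      by (rule bounded_linear.has_vector_derivative[OF bounded_linear_Re])
    have deriv: "(G has_real_derivative G' s) (at s)"
      unfolding G_def G'_def using p q
      by (auto intro!: derivative_eq_intros h simp del: times_complex.sel)
    \<comment> \<open>Here the assumption on \<open>Re z\<close> enters: the mixed term decays like
      the geometric mean of the other two, so it is controlled by the product
      \<open>A * B\<close>.\<close>
    have norm_exp: "cmod (exp (- (of_real s * z))) = exp (- q * s / 2) * exp (- p * s / 2)"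
      by (simp add: z field_simps flip: exp_add)
    define A where "A = exp (- q * s / 2) * cmod v"
    define B where "B = exp (- p * s / 2) * cmod (z * k)"
    have "\<bar>Re (v * k * (z * exp (- (of_real s * z))))\<bar>
        \<le> cmod (v * k * (z * exp (- (of_real s * z))))"
      by (rule abs_Re_le_cmod)
    also have "\<dots> = A * B"
      unfolding norm_mult norm_exp A_def B_def by (simp add: mult_ac)
    finally have "\<bar>Re (v * k * (z * exp (- (of_real s * z))))\<bar> \<le> A * B" .
    moreover have "q * exp (- q * s) * (cmod v)\<^sup>2 = q * A\<^sup>2"
      by (simp add: A_def power_mult_distrib flip: exp_double)
    moreover have "(cmod (z * k))\<^sup>2 / q * exp (- p * s) = B\<^sup>2 / q"
      by (simp add: B_def power_mult_distrib flip: exp_double)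
    ultimately have "q * A\<^sup>2 - 2 * (A * B) + B\<^sup>2 / q \<le> G' s"
      unfolding G'_def by linarith
    moreover have "q * A\<^sup>2 - 2 * (A * B) + B\<^sup>2 / q = (q * A - B)\<^sup>2 / q"
      using q by (simp add: field_simps power2_eq_square)
    ultimately have "0 \<le> G' s"
      using divide_nonneg_pos[of "(q * A - B)\<^sup>2" q] q zero_le_power2 by smt
    with deriv show "\<exists>d. (G has_real_derivative d) (at s) \<and> 0 \<le> d" by blast
  qed
  then show ?thesis by (simp add: G_def h_def)
qed

text \<open>Divided by lam^t, the half-plane inequality becomes \<open>semigroup_form_nonneg\<close>
  with p = ln lam and q = 2 \<beta>.\<close>

lemma embeddable_psi1:
  assumes lam: "lam > 1" and \<beta>: "\<beta> > 0"
    and \<alpha>: "\<alpha> = exp (- of_real \<beta> + \<i> * of_real \<gamma>)"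
    and c: "Im c \<ge> (lam - 1) / (2 * \<beta> * ln lam)
         * (((ln lam / 2 + \<beta>)\<^sup>2 + \<gamma>\<^sup>2) / (cmod (of_real lam - of_real (sqrt lam) * \<alpha>))\<^sup>2)
         * (cmod b)\<^sup>2"
  shows "embeddable (psi1 lam \<alpha> b c) siegel"
proof -
  define L where "L = ln lam"
  have L: "L > 0" "exp L = lam" using lam by (simp_all add: L_def)
  \<comment> \<open>A logarithm of the coefficient \<open>\<mu>\<close> of \<open>u2\<close>; the
    semigroup acts on \<open>u2\<close> by \<open>exp (of_real t * \<kappa>)\<close>.\<close>
  define \<kappa> where "\<kappa> = of_real (L/2 - \<beta>) + \<i> * of_real \<gamma>"
  \<comment> \<open>The exponent left in the mixed term after division by lam^t. Its real part is
    L/2 + \<beta>, and its squared modulus is the numerator in the bound on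
    \<open>Im c\<close>.\<close>
  define z where "z = of_real L - \<kappa>"
  define \<mu> where "\<mu> = of_real (sqrt lam) * \<alpha>"
  have sqrt: "exp (L/2) = sqrt lam"
  proof -
    have "(exp (L/2))\<^sup>2 = lam" using L by (simp flip: exp_double)
    then show ?thesis using real_sqrt_unique by fastforce
  qed
  have \<mu>: "exp \<kappa> = \<mu>"
  proof -
    have "exp \<kappa> = exp (of_real (L/2) + (- of_real \<beta> + \<i> * of_real \<gamma>))"
      by (simp add: \<kappa>_def algebra_simps)
    also have "\<dots> = exp (of_real (L/2)) * \<alpha>"
      unfolding \<alpha> by (rule exp_add)
    also have "exp (of_real (L/2)) = (of_real (exp (L/2)) :: complex)"
      by (rule exp_of_real)
    finally show ?thesis by (simp add: \<mu>_def sqrt)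
  qed
  have "cmod \<mu> < lam"
  proof -
    have "cmod \<mu> = exp (L/2 - \<beta>)" by (simp add: \<mu>[symmetric] \<kappa>_def)
    also have "\<dots> < exp L" using \<beta> L(1) by simp
    finally show ?thesis using L by simp
  qed
  then have ne: "of_real lam - \<mu> \<noteq> 0" by auto
  \<comment> \<open>The difference of the two exponentials solves the composition law for
    \<open>P\<close>, and \<open>k\<close> scales it so that \<open>P 1 = 2 * \<i> * cnj b\<close>.
    This is the origin of the denominator in the bound on \<open>Im c\<close>.\<close>
  define k where "k = cnj b / (of_real lam - \<mu>)"
  define P where "P t = 2 * \<i> * k * (of_real (exp (t * L)) - exp (of_real t * \<kappa>))" for t
  define c' where "c' = c / of_real (lam - 1)"
  have c': "Im c' = Im c / (lam - 1)" "c' * of_real (lam - 1) = c"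
    using lam by (simp_all only: c'_def Im_divide_of_real) simp
  define C where "C t = c' * of_real (exp (t * L) - 1)" for t
  show ?thesis
  proof (rule embeddable_aff[where r = "\<lambda>t. exp (t * L)" and P = P and C = C
        and Q = "\<lambda>t. exp (of_real t * \<kappa>)" and R = "\<lambda>_. 0"])
    fix t :: real and v :: complex
    assume t: "0 \<le> t"
    have "(cmod z)\<^sup>2 = (L/2 + \<beta>)\<^sup>2 + \<gamma>\<^sup>2"
      by (simp add: cmod_power2 z_def \<kappa>_def)
    then have "(lam - 1) * ((cmod (z * k))\<^sup>2 / (L * (2 * \<beta>))) \<le> Im c"
      using c by (simp add: k_def norm_mult norm_divide power_mult_distrib power_divide
          L_def \<mu>_def mult_ac)
    then have "(cmod (z * k))\<^sup>2 / (L * (2 * \<beta>)) \<le> Im c / (lam - 1)"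
      using lam by (simp add: pos_le_divide_eq mult.commute)
    then have "(cmod (z * k))\<^sup>2 / (L * (2 * \<beta>)) * (1 - exp (- L * t)) \<le> Im c / (lam - 1) * (1 - exp (- L * t))"
      using t L by (intro mult_right_mono) auto
    then have "0 \<le> (1 - exp (- (2 * \<beta>) * t)) * (cmod v)\<^sup>2
        + 2 * Re (v * k * (1 - exp (- (of_real t * z)))) + Im c / (lam - 1) * (1 - exp (- L * t))"
      using semigroup_form_nonneg[of L "2 * \<beta>" z t v k] L \<beta> t by (simp add: z_def \<kappa>_def)
    \<comment> \<open>Multiplying back by lam^t: the exponents satisfy L - 2 \<beta> = 2 Re \<kappa>
      and L - z = \<kappa>, which restores the coefficients of the semigroup.\<close>
    then have "0 \<le> exp (t * L) * ((1 - exp (- (2 * \<beta>) * t)) * (cmod v)\<^sup>2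
        + 2 * Re (v * k * (1 - exp (- (of_real t * z)))) + Im c / (lam - 1) * (1 - exp (- L * t)))"
      by simp
    also have "\<dots> = exp (t * L) * (cmod v)\<^sup>2 - (exp (t * L) * exp (- (2 * \<beta>) * t)) * (cmod v)\<^sup>2
        + 2 * (exp (t * L) * Re (v * k * (1 - exp (- (of_real t * z)))))
        + Im c / (lam - 1) * (exp (t * L) - exp (t * L) * exp (- L * t))"
      by (simp add: algebra_simps)
    also have "exp (t * L) * exp (- L * t) = 1" by (simp flip: exp_add)
    also have "exp (t * L) * exp (- (2 * \<beta>) * t) = (cmod (exp (of_real t * \<kappa>)))\<^sup>2"
      by (simp add: \<kappa>_def algebra_simps flip: exp_add exp_double)
    also have "exp (t * L) * Re (v * k * (1 - exp (- (of_real t * z))))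
        = Re (v * k * (of_real (exp (t * L)) * (1 - exp (- (of_real t * z)))))"
      by (simp add: algebra_simps)
    also have "of_real (exp (t * L)) * (1 - exp (- (of_real t * z)))
        = of_real (exp (t * L)) - exp (of_real t * \<kappa>)"
    proof -
      have "complex_of_real (exp (t * L)) * exp (- (of_real t * z)) = exp (of_real t * \<kappa>)"
        unfolding exp_of_real[symmetric] exp_add[symmetric] by (simp add: z_def algebra_simps)
      then show ?thesis by (simp add: right_diff_distrib)
    qed
    finally have nonneg: "0 \<le> exp (t * L) * (cmod v)\<^sup>2 - (cmod (exp (of_real t * \<kappa>)))\<^sup>2 * (cmod v)\<^sup>2
        + 2 * Re (v * k * (of_real (exp (t * L)) - exp (of_real t * \<kappa>)))
        + Im c / (lam - 1) * (exp (t * L) - 1)" .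
    define X where "X = v * k * (of_real (exp (t * L)) - exp (of_real t * \<kappa>))"
    have "P t * v = 2 * \<i> * X" by (simp add: P_def X_def mult_ac)
    then have "Im (P t * v + C t) = 2 * Re X + Im c / (lam - 1) * (exp (t * L) - 1)"
      by (simp add: C_def c')
    then show "(cmod (exp (of_real t * \<kappa>) * v + 0))\<^sup>2
        \<le> exp (t * L) * (cmod v)\<^sup>2 + Im (P t * v + C t)"
      using nonneg unfolding X_def[symmetric] norm_mult power_mult_distrib add_0_right
      by linarith
  next
    show "P (t + s) = of_real (exp (t * L)) * P s + P t * exp (of_real s * \<kappa>)" for s t
      by (simp add: P_def distrib_right exp_add algebra_simps)
  next
    show "C (t + s) = of_real (exp (t * L)) * C s + P t * 0 + C t" for s t
      by (simp add: C_def exp_add algebra_simps)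
  next
    fix u :: "complex ^ 2"
    have "P 1 = 2 * \<i> * cnj b"
      using ne L(2) by (simp add: P_def \<mu> k_def)
    then show "psi1 lam \<alpha> b c u =
        aff (of_real (exp (1 * L))) (P 1) (C 1) (exp (of_real 1 * \<kappa>)) 0 u"
      using lam L by (intro vec2_eqI) (auto simp: psi1_def C_def c'(2)[simplified] \<mu> \<mu>_def)
  qed (auto intro!: continuous_intros simp: P_def C_def exp_add distrib_right L lam)
qed

section \<open>The Cayley transform\<close>

lemma herm_2: "herm z w = z $ 1 * cnj (w $ 1) + z $ 2 * cnj (w $ 2)"
  for z w :: "complex ^ 2"
  by (simp add: herm_def sum_2)

lemma herm_add_left: "herm (x + y) w = herm x w + herm y w"
  by (simp add: herm_def algebra_simps sum.distrib)

lemma herm_smult_left: "herm (c *s x) w = c * herm x w"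
  by (simp add: herm_def sum_distrib_left mult.assoc)

lemma norm_power2_2: "(norm z)\<^sup>2 = (cmod (z $ 1))\<^sup>2 + (cmod (z $ 2))\<^sup>2"
  for z :: "complex ^ 2"
  by (simp add: norm_vec_def L2_set_def sum_2)

text \<open>Completes a unit vector \<open>w\<close> to an orthonormal basis for
  \<open>herm\<close>. The Cayley transform is written in this basis instead of first rotating
  \<open>w\<close> to a coordinate vector.\<close>

definition perp :: "complex ^ 2 \<Rightarrow> complex ^ 2" where
  "perp w = vector [- cnj (w $ 2), cnj (w $ 1)]"

lemma perp_nth [simp]: "perp w $ 1 = - cnj (w $ 2)" "perp w $ 2 = cnj (w $ 1)"
  by (simp_all add: perp_def)

text \<open>The defining function of the half-plane, the counterpart of 1 - |z|^2 on the
  ball.\<close>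

definition rho :: "complex ^ 2 \<Rightarrow> real" where
  "rho u = Im (u $ 1) - (cmod (u $ 2))\<^sup>2"

lemma mem_siegel_iff: "u \<in> siegel \<longleftrightarrow> rho u > 0"
  by (auto simp: siegel_def rho_def)

lemma siegel_add_ii_nonzero:
  assumes "u \<in> siegel"
  shows "u $ 1 + \<i> \<noteq> 0"
proof
  assume "u $ 1 + \<i> = 0"
  then have "Im (u $ 1 + \<i>) = 0" by simp
  moreover have "Im (u $ 1) > 0"
    using assms le_less_trans[OF zero_le_power2] by (simp add: siegel_def)
  ultimately show False by simp
qed

text \<open>The Cayley transform onto the Siegel half-plane that sends the boundary point \<open>w\<close> to infinity,
  and its inverse.\<close>

definition cayley :: "complex ^ 2 \<Rightarrow> complex ^ 2 \<Rightarrow> complex ^ 2" where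
  "cayley w z = vector [\<i> * (1 + herm z w) / (1 - herm z w), herm z (perp w) / (1 - herm z w)]"

definition cayley_inv :: "complex ^ 2 \<Rightarrow> complex ^ 2 \<Rightarrow> complex ^ 2" where
  "cayley_inv w u = ((u $ 1 - \<i>) / (u $ 1 + \<i>)) *s w + (2 * \<i> * u $ 2 / (u $ 1 + \<i>)) *s perp w"

lemma cayley_nth [simp]:
  "cayley w z $ 1 = \<i> * (1 + herm z w) / (1 - herm z w)"
  "cayley w z $ 2 = herm z (perp w) / (1 - herm z w)"
  by (simp_all add: cayley_def)

context
  fixes w :: "complex ^ 2"
  assumes w: "norm w = 1"
begin

lemma herm_unit: "w $ 1 * cnj (w $ 1) + w $ 2 * cnj (w $ 2) = 1"
proof -
  have "complex_of_real ((cmod (w $ 1))\<^sup>2 + (cmod (w $ 2))\<^sup>2) = 1"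
    using w norm_power2_2[of w] by simp
  then show ?thesis by (simp only: of_real_add complex_norm_square)
qed

lemma herm_unit_basis:
  "herm w w = 1" "herm w (perp w) = 0" "herm (perp w) w = 0" "herm (perp w) (perp w) = 1"
  using herm_unit by (simp_all add: herm_2 algebra_simps)

lemma norm_power2_herm: "(norm z)\<^sup>2 = (cmod (herm z w))\<^sup>2 + (cmod (herm z (perp w)))\<^sup>2"
proof -
  have "complex_of_real ((cmod (herm z w))\<^sup>2 + (cmod (herm z (perp w)))\<^sup>2)
      = (z $ 1 * cnj (z $ 1) + z $ 2 * cnj (z $ 2)) * (w $ 1 * cnj (w $ 1) + w $ 2 * cnj (w $ 2))"
    unfolding of_real_add complex_norm_square by (simp add: herm_2 algebra_simps)
  also have "\<dots> = complex_of_real ((norm z)\<^sup>2)"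
    unfolding norm_power2_2 of_real_add complex_norm_square herm_unit by simp
  finally show ?thesis by (metis of_real_eq_iff)
qed

lemma herm_expansion: "z = herm z w *s w + herm z (perp w) *s perp w"
proof (rule vec2_eqI)
  have "z $ 1 = z $ 1 * (w $ 1 * cnj (w $ 1) + w $ 2 * cnj (w $ 2))"
    using herm_unit by simp
  then show "z $ 1 = (herm z w *s w + herm z (perp w) *s perp w) $ 1"
    by (simp add: herm_2 algebra_simps)
  have "z $ 2 = z $ 2 * (w $ 1 * cnj (w $ 1) + w $ 2 * cnj (w $ 2))"
    using herm_unit by simp
  then show "z $ 2 = (herm z w *s w + herm z (perp w) *s perp w) $ 2"
    by (simp add: herm_2 algebra_simps)
qed

lemma herm_neq_1:
  assumes "z \<in> ball 0 1"
  shows "1 - herm z w \<noteq> 0"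
proof
  assume "1 - herm z w = 0"
  then have "1 \<le> (norm z)\<^sup>2"
    using norm_power2_herm[of z] by simp
  then show False
    using assms by (simp add: abs_square_less_1 flip: not_less)
qed

text \<open>An exact formula rather than mere positivity, because the dilation quotient is later
  computed from it.\<close>

lemma rho_cayley:
  assumes "1 - herm z w \<noteq> 0"
  shows "rho (cayley w z) = (1 - (norm z)\<^sup>2) / (cmod (1 - herm z w))\<^sup>2"
proof -
  define h where "h = herm z w"
  have "Im (\<i> * (1 + h) / (1 - h)) = Re ((1 + h) / (1 - h))"
    by (simp add: Re_divide Im_divide)
  also have "\<dots> = (1 - (cmod h)\<^sup>2) / (cmod (1 - h))\<^sup>2"
    unfolding cmod_power2 by (simp add: Re_divide power2_eq_square algebra_simps)
  finally show ?thesis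
    unfolding rho_def norm_power2_herm[of z]
    by (simp add: h_def norm_divide power_divide diff_divide_distrib add_divide_distrib)
qed

lemma herm_cayley_inv:
  "herm (cayley_inv w u) w = (u $ 1 - \<i>) / (u $ 1 + \<i>)"
  "herm (cayley_inv w u) (perp w) = 2 * \<i> * u $ 2 / (u $ 1 + \<i>)"
  by (simp_all add: cayley_inv_def herm_add_left herm_smult_left herm_unit_basis)

lemma norm_cayley_inv:
  assumes "u \<in> siegel"
  shows "1 - (norm (cayley_inv w u))\<^sup>2 = 4 * rho u / (cmod (u $ 1 + \<i>))\<^sup>2"
proof -
  define m where "m = (cmod (u $ 1 + \<i>))\<^sup>2"
  have m: "m \<noteq> 0"
    using siegel_add_ii_nonzero[OF assms] by (simp add: m_def)
  have "(cmod (u $ 1 - \<i>))\<^sup>2 = m - 4 * Im (u $ 1)"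
    unfolding m_def cmod_power2 by (simp add: power2_eq_square algebra_simps)
  then have norm_eq: "(norm (cayley_inv w u))\<^sup>2 = (m - 4 * Im (u $ 1)) / m + 4 * (cmod (u $ 2))\<^sup>2 / m"
    by (simp add: norm_power2_herm herm_cayley_inv norm_divide norm_mult power_divide
        power_mult_distrib m_def)
  show ?thesis
    unfolding m_def[symmetric] norm_eq using m by (simp add: rho_def field_simps)
qed

lemma cayley_add_ii:
  assumes "z \<in> ball 0 1"
  shows "cayley w z $ 1 + \<i> = 2 * \<i> / (1 - herm z w)"
  using herm_neq_1[OF assms] by (simp add: field_simps)

lemma cayley_siegel:
  assumes "z \<in> ball 0 1"
  shows "cayley w z \<in> siegel"
  using herm_neq_1[OF assms] assms
  by (simp add: mem_siegel_iff rho_cayley abs_square_less_1)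

lemma cayley_inv_ball:
  assumes "u \<in> siegel"
  shows "cayley_inv w u \<in> ball 0 1"
proof -
  have "0 < 4 * rho u / (cmod (u $ 1 + \<i>))\<^sup>2"
    using assms siegel_add_ii_nonzero[OF assms] by (simp add: mem_siegel_iff)
  then have "(norm (cayley_inv w u))\<^sup>2 < 1"
    unfolding norm_cayley_inv[OF assms, symmetric] by simp
  then show ?thesis by (simp add: abs_square_less_1)
qed

lemma cayley_cayley_inv:
  assumes "u \<in> siegel"
  shows "cayley w (cayley_inv w u) = u"
proof -
  note ne = siegel_add_ii_nonzero[OF assms]
  have "1 - herm (cayley_inv w u) w = 2 * \<i> / (u $ 1 + \<i>)"
    using ne by (simp add: herm_cayley_inv field_simps)
  moreover have "1 + herm (cayley_inv w u) w = 2 * u $ 1 / (u $ 1 + \<i>)"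
    using ne by (simp add: herm_cayley_inv field_simps)
  ultimately show ?thesis
    using ne by (intro vec2_eqI) (simp_all add: herm_cayley_inv)
qed

lemma cayley_inv_cayley:
  assumes "z \<in> ball 0 1"
  shows "cayley_inv w (cayley w z) = z"
proof -
  note ne = herm_neq_1[OF assms]
  have "cayley w z $ 1 - \<i> = 2 * \<i> * herm z w / (1 - herm z w)"
    using ne by (simp add: field_simps)
  then have "cayley_inv w (cayley w z) = herm z w *s w + herm z (perp w) *s perp w"
    using ne unfolding cayley_inv_def cayley_add_ii[OF assms] by simp
  then show ?thesis using herm_expansion[of z] by simp
qed

lemma holomorphic_map_on_cayley: "holomorphic_map_on (cayley w) (ball 0 1)"
proof (rule holomorphic_map_onI)
  fix z :: "complex ^ 2" and i :: 2
  assume "z \<in> ball 0 1"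
  then have ne: "1 - (z $ 1 * cnj (w $ 1) + z $ 2 * cnj (w $ 2)) \<noteq> 0"
    using herm_neq_1 by (simp add: herm_2)
  have "\<forall>i. complex_differentiable_at (\<lambda>z. cayley w z $ i) z"
    unfolding forall_2 cayley_nth herm_2 by (intro conjI complex_differentiable_intros ne)
  then show "complex_differentiable_at (\<lambda>z. cayley w z $ i) z" ..
qed

lemma holomorphic_map_on_cayley_inv: "holomorphic_map_on (cayley_inv w) siegel"
proof (rule holomorphic_map_onI)
  fix u :: "complex ^ 2" and i :: 2
  assume u: "u \<in> siegel"
  show "complex_differentiable_at (\<lambda>u. cayley_inv w u $ i) u"
    unfolding cayley_inv_def vector_add_component vector_smult_component
    by (intro complex_differentiable_intros siegel_add_ii_nonzero u)
qed

end

section \<open>Linear fractional maps in Siegel coordinates\<close>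

lemma affine_line_bounded:
  fixes x k :: complex
  assumes "\<And>t::real. cmod (x * of_real t + k) \<le> M"
  shows "x = 0"
proof (rule ccontr)
  assume x: "x \<noteq> 0"
  define t where "t = (M + cmod k + 1) / cmod x"
  have "M \<ge> 0" using assms[of 0] norm_ge_zero order_trans by blast
  then have "cmod (x * of_real t) = M + cmod k + 1"
    using x by (simp add: t_def norm_mult del: of_real_divide of_real_add)
  moreover have "cmod (x * of_real t) \<le> M + cmod k"
    using assms[of t] norm_triangle_ineq4[of "x * of_real t + k" k] by simp
  ultimately show False by simp
qed

text \<open>Test points with arbitrary \<open>u2\<close>, arbitrary real part of \<open>u1\<close>,
  and prescribed height \<open>e\<close> above the boundary.\<close>

lemma siegel_point: "e > 0 \<Longrightarrow> vector [of_real t + \<i> * of_real ((cmod v)\<^sup>2 + e), v] \<in> siegel"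
  by (simp add: siegel_def)

lemma affine_bounded_siegel:
  assumes bd: "\<And>u. u \<in> siegel \<Longrightarrow> cmod (x * u $ 1 + y * u $ 2 + k) \<le> M"
  shows "x = 0" "y = 0"
proof -
  show x: "x = 0"
  proof (rule affine_line_bounded)
    show "cmod (x * of_real t + (x * \<i> + k)) \<le> M" for t
      using bd[OF siegel_point[of 1 t 0]] by (simp add: algebra_simps)
  qed
  show "y = 0"
  proof (rule affine_line_bounded)
    show "cmod (y * of_real t + k) \<le> M" for t
      using bd[OF siegel_point[of 1 0 "of_real t"]] by (simp add: x)
  qed
qed

text \<open>A nonconstant affine function of \<open>u2\<close> has a zero, and every value of
  \<open>u2\<close> occurs in the half-plane.\<close>

lemma affine_nonzero_siegel:
  assumes "\<And>u. u \<in> siegel \<Longrightarrow> y * u $ 2 + k \<noteq> 0"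
  shows "y = 0" "k \<noteq> 0"
proof -
  have ne: "y * v + k \<noteq> 0" for v
    using assms[OF siegel_point[of 1 0 v]] by simp
  show "k \<noteq> 0" using ne[of 0] by simp
  show "y = 0"
  proof (rule ccontr)
    assume "y \<noteq> 0"
    then show False using ne[of "- k / y"] by simp
  qed
qed

text \<open>Converse of \<open>aff_siegel\<close>. Moving Re u1 along the real line rules out
  \<open>Im l \<noteq> 0\<close>, large heights rule out \<open>Re l < 0\<close>, and letting the
  height tend to 0 gives the boundary inequality.\<close>

lemma aff_siegelD:
  assumes self: "\<And>u. u \<in> siegel \<Longrightarrow> aff l p c q d u \<in> siegel" and l: "l \<noteq> 0"
  obtains r where "r > 0" "l = of_real r"
    "\<And>v. (cmod (q * v + d))\<^sup>2 \<le> r * (cmod v)\<^sup>2 + Im (p * v + c)"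
proof
  have ineq: "(cmod (q * v + d))\<^sup>2 < Im l * t + Re l * ((cmod v)\<^sup>2 + e) + Im (p * v + c)"
    if "e > 0" for t e v
    using self[OF siegel_point[OF that, of t v]] by (simp add: siegel_def algebra_simps)
  have pos: "0 < Im l * t + Re l * e + Im c" if "e > 0" for t e
    using ineq[OF that, of 0 t] le_less_trans[OF zero_le_power2] by simp
  have "Im l = 0"
  proof (rule ccontr)
    assume "Im l \<noteq> 0"
    then show False using pos[of 1 "- (Re l + Im c) / Im l"] by simp
  qed
  moreover have "Re l \<ge> 0"
  proof (rule ccontr)
    assume "\<not> Re l \<ge> 0"
    then have "(\<bar>Im c\<bar> + 1) / (- Re l) > 0"
      by (intro divide_pos_pos) auto
    from pos[OF this, of 0] show False
      using \<open>\<not> Re l \<ge> 0\<close> by simp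
  qed
  ultimately show "Re l > 0" and l_eq: "l = of_real (Re l)"
    using l by (auto simp: complex_eq_iff)
  show "(cmod (q * v + d))\<^sup>2 \<le> Re l * (cmod v)\<^sup>2 + Im (p * v + c)" for v
  proof (rule field_le_epsilon)
    fix e :: real assume "e > 0"
    then show "(cmod (q * v + d))\<^sup>2 \<le> Re l * (cmod v)\<^sup>2 + Im (p * v + c) + e"
      using ineq[of "e / Re l" v 0] \<open>Re l > 0\<close> by (simp add: algebra_simps)
  qed
qed

lemma continuous_at_herm: "isCont (\<lambda>z. herm z w) x"
  unfolding herm_def by (intro continuous_intros)

lemma LFM_cayley_aff:
  fixes w :: "complex ^ 2"
  assumes LFM: "\<phi> \<in> LFM" and w: "norm w = 1"
    and no_fix: "\<And>z. z \<in> ball 0 1 \<Longrightarrow> \<phi> z \<noteq> z"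
    and lim: "(\<lambda>n. (\<phi> ^^ n) 0) \<longlonglongrightarrow> w"
  obtains l p c q d where "l \<noteq> 0"
    "\<And>u. u \<in> siegel \<Longrightarrow> cayley w (\<phi> (cayley_inv w u)) = aff l p c q d u"
proof -
  obtain A :: "complex ^ 2 ^ 2" and B C D where
    den: "\<And>z. z \<in> ball 0 1 \<Longrightarrow> herm z C + D \<noteq> 0" and
    \<phi>: "\<And>z. z \<in> ball 0 1 \<Longrightarrow> \<phi> z = (1 / (herm z C + D)) *s (A *v z + B)"
    using LFM unfolding LFM_def by blast
  have self: "\<phi> z \<in> ball 0 1" if "z \<in> ball 0 1" for z
    using LFM that unfolding LFM_def holomorphic_self_map_def by blast
  \<comment> \<open>Multiplication by \<open>u $ 1 + \<i>\<close> clears the pole of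
    \<open>cayley_inv\<close>, which turns the denominator of \<open>\<phi>\<close> and the pairings
    of its numerator into affine functions \<open>E\<close> and \<open>N y\<close> of
    \<open>u\<close>.\<close>
  define e1 where "e1 = herm w C + D"
  define e2 where "e2 = 2 * \<i> * herm (perp w) C"
  define e3 where "e3 = \<i> * (D - herm w C)"
  define E where "E u = e1 * u $ 1 + e2 * u $ 2 + e3" for u :: "complex ^ 2"
  define n1 where "n1 y = herm (A *v w + B) y" for y
  define n2 where "n2 y = 2 * \<i> * herm (A *v perp w) y" for y
  define n3 where "n3 y = \<i> * (herm B y - herm (A *v w) y)" for y
  define N where "N y u = n1 y * u $ 1 + n2 y * u $ 2 + n3 y" for y and u :: "complex ^ 2"
  have E: "(u $ 1 + \<i>) * (herm (cayley_inv w u) C + D) = E u" if "u \<in> siegel" for u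
    using siegel_add_ii_nonzero[OF that]
    by (simp add: cayley_inv_def herm_add_left herm_smult_left E_def e1_def e2_def e3_def
        distrib_left) (simp add: algebra_simps)
  have N: "(u $ 1 + \<i>) * herm (A *v cayley_inv w u + B) y = N y u" if "u \<in> siegel" for u y
    using siegel_add_ii_nonzero[OF that]
    by (simp add: cayley_inv_def herm_add_left herm_smult_left N_def n1_def n2_def n3_def
        distrib_left matrix_vector_right_distrib vector_scalar_commute)
       (simp add: algebra_simps)
  have E_nz: "E u \<noteq> 0" if "u \<in> siegel" for u
    unfolding E[OF that, symmetric]
    using siegel_add_ii_nonzero[OF that] den[OF cayley_inv_ball[OF w that]] by simp
  have herm_\<phi>: "herm (\<phi> (cayley_inv w u)) y = N y u / E u" if "u \<in> siegel" for u y
    unfolding E[OF that, symmetric] N[OF that, symmetric] \<phi>[OF cayley_inv_ball[OF w that]]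
    using siegel_add_ii_nonzero[OF that]
    by (simp add: herm_smult_left del: vector_add_ldistrib)
  have self_cayley: "\<phi> (cayley_inv w u) \<in> ball 0 1" if "u \<in> siegel" for u
    using self cayley_inv_ball[OF w that] by blast
  \<comment> \<open>\<open>e1\<close> is the denominator of \<open>\<phi>\<close> at
    \<open>w\<close>. If it vanished, \<open>E\<close> would be a zero-free affine function of
    \<open>u2\<close>, hence constant; then each \<open>N y\<close> would be bounded and so
    constant, and \<open>\<phi>\<close> would be a constant self-map, which fixes its value.\<close>
  have e1: "e1 \<noteq> 0"
  proof
    assume "e1 = 0"
    then have "e2 = 0"
      using affine_nonzero_siegel[of e2 e3] E_nz by (simp add: E_def)
    with \<open>e1 = 0\<close> have E_const: "E u = e3" for u by (simp add: E_def)
    have le: "cmod (N y u) \<le> cmod e3" if "u \<in> siegel" "y = w \<or> y = perp w" for u y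
    proof -
      have "(cmod (herm (\<phi> (cayley_inv w u)) y))\<^sup>2 \<le> (norm (\<phi> (cayley_inv w u)))\<^sup>2"
        using that(2) by (auto simp: norm_power2_herm[OF w])
      also have "\<dots> \<le> 1"
        using self_cayley[OF that(1)] by (simp add: abs_square_le_1)
      finally have "cmod (N y u / e3) \<le> 1"
        by (simp add: herm_\<phi>[OF that(1)] E_const abs_square_le_1)
      then show ?thesis
        using E_nz[OF that(1)] by (simp add: E_const norm_divide)
    qed
    have "N y u = n3 y" if "y = w \<or> y = perp w" for u y
      using affine_bounded_siegel[of "n1 y" "n2 y" "n3 y" "cmod e3"] le[OF _ that]
      by (simp add: N_def)
    then have "\<phi> (cayley_inv w u) = (n3 w / e3) *s w + (n3 (perp w) / e3) *s perp w"
      if "u \<in> siegel" for u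
      using herm_expansion[OF w, of "\<phi> (cayley_inv w u)"] herm_\<phi>[OF that] by (simp add: E_const)
    then have const: "\<phi> z = (n3 w / e3) *s w + (n3 (perp w) / e3) *s perp w" if "z \<in> ball 0 1" for z
      using cayley_siegel[OF w that] cayley_inv_cayley[OF w that] by metis
    have "0 \<in> ball (0 :: complex ^ 2) 1" by simp
    then show False
      using const no_fix self by metis
  qed
  \<comment> \<open>Passing to the limit along the orbit of 0 in the equation with the denominator
    cleared.\<close>
  have fix_w: "A *v w + B = e1 *s w"
  proof -
    have ball: "(\<phi> ^^ n) 0 \<in> ball 0 1" for n
      by (induction n) (use self in auto)
    have "(\<lambda>n. (\<phi> ^^ Suc n) 0) \<longlonglongrightarrow> w"
      using lim by (rule LIMSEQ_Suc)
    then have "(\<lambda>n. (herm ((\<phi> ^^ n) 0) C + D) *s (\<phi> ^^ Suc n) 0) \<longlonglongrightarrow> e1 *s w"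
      unfolding e1_def vector_scalar_mult_def
      by (intro tendsto_intros isCont_tendsto_compose[OF continuous_at_herm lim])
    moreover have "(herm ((\<phi> ^^ n) 0) C + D) *s (\<phi> ^^ Suc n) 0 = A *v (\<phi> ^^ n) 0 + B" for n
      using \<phi>[OF ball[of n]] den[OF ball[of n]] by simp
    moreover have "(\<lambda>n. A *v (\<phi> ^^ n) 0 + B) \<longlonglongrightarrow> A *v w + B"
      unfolding matrix_vector_mult_def
      by (intro tendsto_intros lim)
    ultimately show ?thesis
      using LIMSEQ_unique by fastforce
  qed
  then have n1: "n1 w = e1" "n1 (perp w) = 0"
    by (simp_all add: n1_def herm_smult_left herm_unit_basis[OF w])
  have diff: "E u - N w u = (e2 - n2 w) * u $ 2 + (e3 - n3 w)" for u
    by (simp add: E_def N_def n1 algebra_simps)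
  \<comment> \<open>A zero would mean \<open>herm z w = 1\<close> for a point \<open>z\<close> of
    the ball. By \<open>fix_w\<close> the \<open>u1\<close> terms have already cancelled in this
    difference.\<close>
  have "E u - N w u \<noteq> 0" if "u \<in> siegel" for u
    using herm_neq_1[OF w self_cayley[OF that]] E_nz[OF that] by (auto simp: herm_\<phi>[OF that])
  then have "e2 = n2 w" and k: "e3 - n3 w \<noteq> 0"
    using affine_nonzero_siegel[of "e2 - n2 w" "e3 - n3 w"] by (auto simp: diff)
  with diff have diff': "E u - N w u = e3 - n3 w" for u by simp
  define k where "k = e3 - n3 w"
  \<comment> \<open>The transformed coordinates are \<i> (E + N w) / (E - N w) and N (perp w) / (E -
    N w), now with the constant denominator \<open>k\<close>; the second has no \<open>u1\<close>
    term because \<open>n1 (perp w) = 0\<close>.\<close>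
  have "cayley w (\<phi> (cayley_inv w u)) = aff (2 * \<i> * e1 / k) (2 * \<i> * e2 / k) (\<i> * (e3 + n3 w) / k)
      (n2 (perp w) / k) (n3 (perp w) / k) u" if u: "u \<in> siegel" for u
  proof -
    have "1 - herm (\<phi> (cayley_inv w u)) w = k / E u"
      using E_nz[OF u] by (simp add: herm_\<phi>[OF u] k_def diff'[of u, symmetric] field_simps)
    moreover have "1 + herm (\<phi> (cayley_inv w u)) w = (E u + N w u) / E u"
      using E_nz[OF u] unfolding add_divide_distrib by (simp add: herm_\<phi>[OF u])
    ultimately have cayley_eq: "cayley w (\<phi> (cayley_inv w u)) $ 1 = \<i> * (E u + N w u) / k"
        "cayley w (\<phi> (cayley_inv w u)) $ 2 = N (perp w) u / k"
      using E_nz[OF u] unfolding cayley_nth by (simp_all add: herm_\<phi>[OF u])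
    show ?thesis
      by (rule vec2_eqI; unfold cayley_eq)
         (simp_all add: E_def N_def n1 \<open>e2 = n2 w\<close> add_divide_distrib algebra_simps)
  qed
  with that[of "2 * \<i> * e1 / k"] e1 k show ?thesis by (simp add: k_def)
qed

text \<open>The dilation quotient is the quotient of the values of \<open>rho\<close>, which is at
  least \<open>r\<close>, times a factor that extends continuously to \<open>w\<close> with value 1
  / r^2. Hence the liminf is at least 1 / r, which would be at least 1 if r <= 1.\<close>

lemma dilation_coefficient_less_1D:
  fixes w :: "complex ^ 2"
  assumes w: "norm w = 1" and self: "\<And>z. z \<in> ball 0 1 \<Longrightarrow> \<phi> z \<in> ball 0 1"
    and f: "\<And>u. u \<in> siegel \<Longrightarrow> cayley w (\<phi> (cayley_inv w u)) = aff (of_real r) p c q d u"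
    and r: "r > 0"
    and le: "\<And>v. (cmod (q * v + d))\<^sup>2 \<le> r * (cmod v)\<^sup>2 + Im (p * v + c)"
    and dil: "dilation_coefficient \<phi> w < 1"
  shows "r > 1"
proof (rule ccontr)
  assume "\<not> r > 1"
  \<comment> \<open>\<open>X z\<close> is the first coordinate of the image plus \<i>, multiplied by
    \<open>1 - herm z w\<close>; in this form it makes sense at \<open>w\<close> itself.\<close>
  define X where "X z = of_real r * \<i> * (1 + herm z w) + p * herm z (perp w) + (c + \<i>) * (1 - herm z w)" for z
  define \<beta> where "\<beta> z = r * (4 / (cmod (X z))\<^sup>2)" for z
  have ratio: "\<beta> z \<le> (1 - (norm (\<phi> z))\<^sup>2) / (1 - (norm z)\<^sup>2)" if z: "z \<in> ball 0 1" for z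
  proof -
    define u where "u = cayley w z"
    have u: "u \<in> siegel" "cayley w (\<phi> z) = aff (of_real r) p c q d u"
      using cayley_siegel[OF w z] f[OF cayley_siegel[OF w z]] cayley_inv_cayley[OF w z]
      by (simp_all add: u_def)
    have pos: "rho u > 0" using u by (simp add: mem_siegel_iff)
    have "r * rho u \<le> rho (aff (of_real r) p c q d u)"
      using le[of "u $ 2"] by (simp add: rho_def algebra_simps)
    then have rho: "r \<le> rho (cayley w (\<phi> z)) / rho u"
      using pos by (simp add: u(2) field_simps)
    have ne: "1 - herm z w \<noteq> 0" "1 - herm (\<phi> z) w \<noteq> 0"
      using herm_neq_1[OF w] z self by blast+
    have "aff (of_real r) p c q d u $ 1 + \<i> = 2 * \<i> / (1 - herm (\<phi> z) w)"
      using cayley_add_ii[OF w self[OF z]] u(2) by simp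
    moreover have "(aff (of_real r) p c q d u $ 1 + \<i>) * (1 - herm z w) = X z"
    proof -
      have "u $ 1 * (1 - herm z w) = \<i> * (1 + herm z w)" "u $ 2 * (1 - herm z w) = herm z (perp w)"
        using ne by (simp_all add: u_def)
      then show ?thesis
        unfolding X_def aff_nth distrib_right mult.assoc by simp
    qed
    ultimately have "X z = 2 * \<i> * (1 - herm z w) / (1 - herm (\<phi> z) w)"
      by simp
    then have X: "4 / (cmod (X z))\<^sup>2 = (cmod (1 - herm (\<phi> z) w))\<^sup>2 / (cmod (1 - herm z w))\<^sup>2"
      by (simp add: norm_divide norm_mult power_divide power_mult_distrib)
    have "\<beta> z \<le> rho (cayley w (\<phi> z)) / rho u * (4 / (cmod (X z))\<^sup>2)"
      unfolding \<beta>_def using rho by (intro mult_right_mono) auto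
    also have "\<dots> = (1 - (norm (\<phi> z))\<^sup>2) / (1 - (norm z)\<^sup>2)"
      using ne unfolding X u_def rho_cayley[OF w ne(1)] rho_cayley[OF w ne(2)] by simp
    finally show ?thesis .
  qed
  have "X w = 2 * of_real r * \<i>"
    by (simp add: X_def herm_unit_basis[OF w])
  then have "\<beta> w = 1 / r" "X w \<noteq> 0"
    using r by (simp_all add: \<beta>_def norm_mult power2_eq_square)
  moreover have "isCont \<beta> w"
    unfolding \<beta>_def using \<open>X w \<noteq> 0\<close>
    by (intro continuous_intros) (auto simp: X_def intro!: continuous_intros continuous_at_herm)
  ultimately have "(\<beta> \<longlongrightarrow> 1 / r) (at w within ball 0 1)"
    by (metis continuous_at_imp_continuous_at_within continuous_within)
  then have lim: "((\<lambda>z. ereal (\<beta> z)) \<longlongrightarrow> ereal (1 / r)) (at w within ball 0 1)"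
    by (rule tendsto_ereal)
  have "1 \<le> dilation_coefficient \<phi> w"
    unfolding dilation_coefficient_def le_Liminf_iff
  proof (intro allI impI)
    fix y :: ereal assume "y < 1"
    moreover have "1 \<le> ereal (1 / r)" using r \<open>\<not> r > 1\<close> by (simp add: one_ereal_def)
    ultimately have "y < ereal (1 / r)" by (rule less_le_trans)
    with lim have "\<forall>\<^sub>F z in at w within ball 0 1. y < ereal (\<beta> z)"
      by (rule order_tendstoD)
    moreover have "\<forall>\<^sub>F z in at w within ball 0 1. z \<in> ball 0 1"
      by (simp add: eventually_at_topological) auto
    ultimately show "\<forall>\<^sub>F z in at w within ball 0 1.
        y < ereal ((1 - (norm (\<phi> z))\<^sup>2) / (1 - (norm z)\<^sup>2))"
    proof eventually_elim
      case (elim z)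
      then show ?case using ratio[of z] by (meson ereal_less_eq(3) less_le_trans)
    qed
  qed
  with dil show False by simp
qed

text \<open>Heisenberg translations, the automorphisms of the Siegel half-plane that translate the
  second coordinate.\<close>

definition heis :: "complex \<Rightarrow> complex ^ 2 \<Rightarrow> complex ^ 2" where
  "heis k = aff (of_real 1) (2 * \<i> * cnj k) (\<i> * of_real ((cmod k)\<^sup>2)) 1 k"

lemma heis_nth:
  "heis k u $ 1 = u $ 1 + 2 * \<i> * cnj k * u $ 2 + \<i> * of_real ((cmod k)\<^sup>2)"
  "heis k u $ 2 = u $ 2 + k"
  by (simp_all add: heis_def)

text \<open>The boundary inequality is an equality: the terms added to \<open>u1\<close> supply
  exactly the cross term and the constant of |u2 + k|^2.\<close>

lemma heis_siegel: "u \<in> siegel \<Longrightarrow> heis k u \<in> siegel"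
  unfolding heis_def
proof (rule aff_siegel)
  show "(cmod (1 * v + k))\<^sup>2 \<le> 1 * (cmod v)\<^sup>2 + Im (2 * \<i> * cnj k * v + \<i> * of_real ((cmod k)\<^sup>2))" for v
    unfolding cmod_power2 by (simp add: power2_eq_square algebra_simps)
qed simp_all

lemma heis_inverse: "heis (- k) (heis k u) = u"
  by (rule vec2_eqI) (simp_all add: heis_def complex_norm_square algebra_simps del: of_real_power)

lemma conjugated_by_heis:
  assumes w: "norm w = 1" and \<phi>: "holomorphic_self_map \<phi> (ball 0 1)"
    and g: "\<And>u. u \<in> siegel \<Longrightarrow> heis (- k) (cayley w (\<phi> (cayley_inv w (heis k u)))) = g u"
  shows "conjugated \<phi> (ball 0 1) g siegel"
proof (rule conjugatedI[OF open_siegel \<phi>])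
  show "holomorphic_map_on (heis (- k) \<circ> cayley w) (ball 0 1)"
    using cayley_siegel[OF w] unfolding heis_def
    by (intro holomorphic_map_on_compose[of _ _ _ siegel] holomorphic_map_on_aff
        holomorphic_map_on_cayley[OF w]) auto
  show "holomorphic_map_on (cayley_inv w \<circ> heis k) siegel"
    using heis_siegel unfolding heis_def
    by (intro holomorphic_map_on_compose[of _ _ _ siegel] holomorphic_map_on_aff
        holomorphic_map_on_cayley_inv[OF w]) auto
  show "(heis (- k) \<circ> cayley w) ` ball 0 1 \<subseteq> siegel"
    using cayley_siegel[OF w] heis_siegel by auto
  show "(cayley_inv w \<circ> heis k) ` siegel \<subseteq> ball 0 1"
    using cayley_inv_ball[OF w] heis_siegel by (auto simp del: mem_ball)
  show "(cayley_inv w \<circ> heis k) ((heis (- k) \<circ> cayley w) z) = z" if "z \<in> ball 0 1" for z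
    using heis_inverse[of "- k" "cayley w z"] cayley_inv_cayley[OF w that] by simp
  show "(heis (- k) \<circ> cayley w) ((cayley_inv w \<circ> heis k) u) = u" if "u \<in> siegel" for u
    using heis_inverse cayley_cayley_inv[OF w heis_siegel[OF that]] by simp
  show "(heis (- k) \<circ> cayley w) (\<phi> ((cayley_inv w \<circ> heis k) u)) = g u" if "u \<in> siegel" for u
    using g[OF that] by simp
qed

section \<open>Normal forms\<close>

lemma hyperbolic_LFM_conjugated:
  fixes \<phi> :: "complex ^ 2 \<Rightarrow> complex ^ 2"
  assumes "\<phi> \<in> LFM" and "hyperbolic \<phi>"
  shows "\<exists>(lam::real) a b c \<alpha>. lam > 1 \<and>
    (conjugated \<phi> (ball 0 1) (psi1 lam \<alpha> b c) siegel \<or>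
     conjugated \<phi> (ball 0 1) (psi2 lam a b) siegel)"
proof -
  obtain w where DW: "denjoy_wolff_point \<phi> w" and dil: "dilation_coefficient \<phi> w < 1"
    and hol: "holomorphic_self_map \<phi> (ball 0 1)" and no_fix: "\<And>z. z \<in> ball 0 1 \<Longrightarrow> \<phi> z \<noteq> z"
    using assms(2) unfolding hyperbolic_def by blast
  have w: "norm w = 1" using DW by (simp add: denjoy_wolff_point_def)
  have self: "\<phi> z \<in> ball 0 1" if "z \<in> ball 0 1" for z
    using hol that unfolding holomorphic_self_map_def by blast
  have "0 \<in> ball (0 :: complex ^ 2) 1" by simp
  then obtain U where "0 \<in> U" "uniform_limit U (\<lambda>n. \<phi> ^^ n) (\<lambda>_. w) sequentially"
    using DW unfolding denjoy_wolff_point_def by blast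
  then have "(\<lambda>n. (\<phi> ^^ n) 0) \<longlonglongrightarrow> w"
    using tendsto_uniform_limitI by fastforce
  then obtain l p c q d where "l \<noteq> 0" and
    f: "\<And>u. u \<in> siegel \<Longrightarrow> cayley w (\<phi> (cayley_inv w u)) = aff l p c q d u"
    using LFM_cayley_aff[OF assms(1) w no_fix] by blast
  have "aff l p c q d u \<in> siegel" if "u \<in> siegel" for u
    using cayley_siegel[OF w self[OF cayley_inv_ball[OF w that]]] f[OF that] by simp
  then obtain r where "r > 0" and l: "l = of_real r" and
    le: "\<And>v. (cmod (q * v + d))\<^sup>2 \<le> r * (cmod v)\<^sup>2 + Im (p * v + c)"
    using aff_siegelD \<open>l \<noteq> 0\<close> by metis
  have r: "r > 1"
    using dilation_coefficient_less_1D[OF w self _ \<open>r > 0\<close> le dil] f l by blast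
  have conj: "conjugated \<phi> (ball 0 1) g siegel"
    if "\<And>u. heis (- k) (aff l p c q d (heis k u)) = g u" for k g
    by (rule conjugated_by_heis[OF w hol, of k]) (simp add: f[OF heis_siegel] that)
  show ?thesis
  proof (cases "q = 1")
    case False
    \<comment> \<open>The fixed point of the second coordinate map, which the Heisenberg translation
      moves to 0.\<close>
    define k where "k = d / (1 - q)"
    have "k * (1 - q) = d" using False by (simp add: k_def)
    then have k: "k - q * k = d" by (simp add: algebra_simps)
    \<comment> \<open>Read off from the coefficient of \<open>u2\<close> after conjugation, which
      has to equal \<open>2 * \<i> * cnj b\<close>.\<close>
    define b where "b = cnj (cnj k * (of_real r - q) + p / (2 * \<i>))"
    have b: "2 * \<i> * (v * cnj b) = 2 * \<i> * of_real r * cnj k * v - 2 * \<i> * cnj k * q * v + p * v" for v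
      by (simp add: b_def algebra_simps)
    define m where "m = \<i> * of_real ((cmod k)\<^sup>2)"
    define c' where "c' = of_real r * m + p * k + c - 2 * \<i> * cnj k * k + m"
    have "heis (- k) (aff l p c q d (heis k u)) = psi1 r (q / of_real (sqrt r)) b c' u" for u
    proof (rule vec2_eqI)
      show "heis (- k) (aff l p c q d (heis k u)) $ 1 = psi1 r (q / of_real (sqrt r)) b c' u $ 1"
        unfolding psi1_def vector_2 b heis_nth aff_nth norm_minus_cancel m_def[symmetric]
          c'_def l k[symmetric]
        by (simp add: algebra_simps)
      show "heis (- k) (aff l p c q d (heis k u)) $ 2 = psi1 r (q / of_real (sqrt r)) b c' u $ 2"
        unfolding psi1_def vector_2 heis_nth aff_nth k[symmetric]
        using r by (simp add: algebra_simps)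
    qed
    then show ?thesis using r conj by blast
  next
    case True
    \<comment> \<open>Now the translation by \<open>d\<close> has no fixed point to move unless d =
      0, but r > 1 allows the conjugated coefficient of \<open>u2\<close> in the first coordinate, p
      + 2 \<i> cnj k (r - 1), to be made zero.\<close>
    define k where "k = cnj (- p / (2 * \<i> * (of_real r - 1)))"
    have "complex_of_real r - 1 \<noteq> 0" using r by simp
    then have "2 * \<i> * cnj k * (of_real r - 1) = - p"
      by (simp add: k_def)
    then have k: "p = 2 * \<i> * cnj k - 2 * \<i> * of_real r * cnj k"
      by (simp add: algebra_simps)
    define m where "m = \<i> * of_real ((cmod k)\<^sup>2)"
    define a where "a = of_real r * m + p * k + c - 2 * \<i> * cnj k * (k + d) + m"
    have "heis (- k) (aff l p c q d (heis k u)) = psi2 r a d u" for u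
    proof (rule vec2_eqI)
      show "heis (- k) (aff l p c q d (heis k u)) $ 1 = psi2 r a d u $ 1"
        unfolding psi2_def vector_2 heis_nth aff_nth norm_minus_cancel m_def[symmetric]
          a_def l True k
        by (simp add: algebra_simps)
      show "heis (- k) (aff l p c q d (heis k u)) $ 2 = psi2 r a d u $ 2"
        by (simp add: psi2_def heis_nth True)
    qed
    then show ?thesis using r conj by blast
  qed
qed

theorem theorem1p12:
  fixes \<phi> :: "complex ^ 2 \<Rightarrow> complex ^ 2"
  assumes "\<phi> \<in> LFM" and "hyperbolic \<phi>"
  shows "(\<exists>(lam::real) a b c \<alpha>. lam > 1 \<and>
            (conjugated \<phi> (ball 0 1) (psi1 lam \<alpha> b c) siegel \<or>
             conjugated \<phi> (ball 0 1) (psi2 lam a b) siegel))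
       \<and> (\<forall>(lam::real) \<alpha> b c (\<beta>::real) (\<gamma>::real).
            lam > 1 \<longrightarrow> holomorphic_self_map (psi1 lam \<alpha> b c) siegel \<longrightarrow>
            \<beta> > 0 \<longrightarrow> 0 \<le> \<gamma> \<longrightarrow> \<gamma> < 2 * pi \<longrightarrow>
            \<alpha> = exp (- of_real \<beta> + \<i> * of_real \<gamma>) \<longrightarrow>
            Im c \<ge> (lam - 1) / (2 * \<beta> * ln lam)
                     * (((ln lam / 2 + \<beta>)\<^sup>2 + \<gamma>\<^sup>2)
                         / (cmod (of_real lam - of_real (sqrt lam) * \<alpha>))\<^sup>2)
                     * (cmod b)\<^sup>2 \<longrightarrow>
            embeddable (psi1 lam \<alpha> b c) siegel)
       \<and> (\<forall>(lam::real) a b.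
            lam > 1 \<longrightarrow> holomorphic_self_map (psi2 lam a b) siegel \<longrightarrow>
            Im a \<ge> (lam - 1) / (ln lam)\<^sup>2 * (cmod b)\<^sup>2 \<longrightarrow>
            embeddable (psi2 lam a b) siegel)"
proof (intro conjI allI impI)
  show "\<exists>(lam::real) a b c \<alpha>. lam > 1 \<and>
      (conjugated \<phi> (ball 0 1) (psi1 lam \<alpha> b c) siegel \<or>
       conjugated \<phi> (ball 0 1) (psi2 lam a b) siegel)"
    by (rule hyperbolic_LFM_conjugated[OF assms])
next
  show "embeddable (psi1 lam \<alpha> b c) siegel"
    if "lam > 1" "\<beta> > 0" "\<alpha> = exp (- of_real \<beta> + \<i> * of_real \<gamma>)"
      and "Im c \<ge> (lam - 1) / (2 * \<beta> * ln lam)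
        * (((ln lam / 2 + \<beta>)\<^sup>2 + \<gamma>\<^sup>2) / (cmod (of_real lam - of_real (sqrt lam) * \<alpha>))\<^sup>2)
        * (cmod b)\<^sup>2"
    for lam \<beta> \<gamma> :: real and \<alpha> b c
    using that by (rule embeddable_psi1)
next
  show "embeddable (psi2 lam a b) siegel"
    if "lam > 1" "Im a \<ge> (lam - 1) / (ln lam)\<^sup>2 * (cmod b)\<^sup>2" for lam a b
    using that by (rule embeddable_psi2)
qed

end
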